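(* Let $A$ be a monoid. A skew monoidal monoid structure on $A$ is the same as the data consisting of two monoid endomorphisms $T,Q:A\to A$ and elements $\mu,\eta,\delta,\varepsilon\in A$ subject to the following axioms. Intertwiner relations, for all $a\in A$: $$\mu T^2(a)=T(a)\mu,\quad \eta a=T(a)\eta,\quad \delta Q(a)=Q^2(a)\delta,\quad a\varepsilon=\varepsilon Q(a),\quad \mu\delta\, TQ(a)=QT(a)\,\mu\delta.$$ Commutation relations, for all $a,b\in A$: $$T(a)Q(b)=Q(b)T(a),\quad \mu Q(a)=Q(a)\mu,\quad \delta T(a)=T(a)\delta.$$ Bimonoid-like relations: $$\mu T(\mu)=\mu^2,\quad \mu\eta=1,\quad \mu T(\eta)=1,\quad Q(\delta)\delta=\delta^2,\quad \varepsilon\delta=1,\quad Q(\varepsilon)\delta=1,$$ $$Q(\mu)\mu\,\delta T(\delta)=\delta\mu,\quad \varepsilon\mu=\varepsilon T(\varepsilon),\quad \delta\eta=Q(\eta)\eta,\quad \varepsilon\eta=1.$$ Explicitly, the assignment sending a skew monoidal monoid structure $\langle *,\gamma,\eta,\varepsilon\rangle$ on $A$ to $\langle T,Q,\mu,\eta,\delta,\varepsilon\rangle$, with $T(a)=1*a$, $Q(a)=a*1$, $\mu=Q(\varepsilon)\gamma$, $\delta=\gamma T(\eta)$, is a bijection onto the set of such data, with inverse given by $a*b=Q(a)T(b)$ and $\gamma=\mu\delta$ (and the same $\eta$, $\varepsilon$).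
   Context: A skew monoidal monoid $\langle A,*,\gamma,\eta,\varepsilon\rangle$ consists of a monoid $A$ with unit $1$, a monoid morphism $A\times A\to A$, $\langle a,b\rangle\mapsto a*b$ (so $(ab)*(cd)=(a*c)(b*d)$ and $1*1=1$), and elements $\gamma,\eta,\varepsilon\in A$ such that for all $a,b,c\in A$ $$\gamma(a*(b*c))=((a*b)*c)\gamma,\qquad \eta a=(1*a)\eta,\qquad a\varepsilon=\varepsilon(a*1),$$ and $$(\gamma*1)\gamma(1*\gamma)=\gamma^2,\quad \gamma\eta=\eta*1,\quad \varepsilon\gamma=1*\varepsilon,\quad (\varepsilon*1)\gamma(1*\eta)=1,\quad \varepsilon\eta=1.$$ *)

theory Defs
  imports Main
begin

text \<open>
  A monoid is a type of class \<open>monoid_mult\<close>. Its multiplication, a juxtaposition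
  on paper, is written \<open>*\<close> here; the skew product, written \<open>*\<close> on paper, is the binary
  operation \<open>\<star>\<close>.
\<close>

locale monoid_endomorphism =
  fixes F :: "'a::monoid_mult \<Rightarrow> 'a"
  assumes map_one: "F 1 = 1"
    and map_mult: "F (a * b) = F a * F b"

text \<open>
  \<open>star_mult\<close> and \<open>star_one\<close> say that \<open>\<star>\<close> is a monoid morphism from the product
  monoid of pairs, which is not an instance of \<open>monoid_mult\<close> in the library.
\<close>

locale skew_monoidal_monoid =
  fixes star :: "'a::monoid_mult \<Rightarrow> 'a \<Rightarrow> 'a"  (infixl "\<star>" 75)
    and \<gamma> \<eta> \<epsilon> :: 'a
  assumes star_mult: "(a * b) \<star> (c * d) = (a \<star> c) * (b \<star> d)"
    and star_one: "1 \<star> 1 = 1"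
    and gamma_natural: "\<gamma> * (a \<star> (b \<star> c)) = ((a \<star> b) \<star> c) * \<gamma>"
    and eta_natural: "\<eta> * a = (1 \<star> a) * \<eta>"
    and epsilon_natural: "a * \<epsilon> = \<epsilon> * (a \<star> 1)"
    and pentagon: "(\<gamma> \<star> 1) * \<gamma> * (1 \<star> \<gamma>) = \<gamma>\<^sup>2"
    and gamma_eta: "\<gamma> * \<eta> = \<eta> \<star> 1"
    and epsilon_gamma: "\<epsilon> * \<gamma> = 1 \<star> \<epsilon>"
    and epsilon_gamma_eta: "(\<epsilon> \<star> 1) * \<gamma> * (1 \<star> \<eta>) = 1"
    and epsilon_eta: "\<epsilon> * \<eta> = 1"

locale skew_data =
  T: monoid_endomorphism T + Q: monoid_endomorphism Q
  for T Q :: "'a::monoid_mult \<Rightarrow> 'a" +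
  fixes \<mu> \<eta> \<delta> \<epsilon> :: 'a
  assumes mu_T: "\<mu> * T (T a) = T a * \<mu>"
    and eta_T: "\<eta> * a = T a * \<eta>"
    and delta_Q: "\<delta> * Q a = Q (Q a) * \<delta>"
    and epsilon_Q: "a * \<epsilon> = \<epsilon> * Q a"
    and mu_delta_TQ: "\<mu> * \<delta> * T (Q a) = Q (T a) * \<mu> * \<delta>"
    and T_Q_commute: "T a * Q b = Q b * T a"
    and mu_Q_commute: "\<mu> * Q a = Q a * \<mu>"
    and delta_T_commute: "\<delta> * T a = T a * \<delta>"
    and mu_T_mu: "\<mu> * T \<mu> = \<mu>\<^sup>2"
    and mu_eta: "\<mu> * \<eta> = 1"
    and mu_T_eta: "\<mu> * T \<eta> = 1"
    and Q_delta_delta: "Q \<delta> * \<delta> = \<delta>\<^sup>2"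
    and epsilon_delta: "\<epsilon> * \<delta> = 1"
    and Q_epsilon_delta: "Q \<epsilon> * \<delta> = 1"
    and delta_mu: "Q \<mu> * \<mu> * \<delta> * T \<delta> = \<delta> * \<mu>"
    and epsilon_mu: "\<epsilon> * \<mu> = \<epsilon> * T \<epsilon>"
    and delta_eta: "\<delta> * \<eta> = Q \<eta> * \<eta>"
    and epsilon_eta: "\<epsilon> * \<eta> = 1"

type_synonym 'a skew_structure = "('a \<Rightarrow> 'a \<Rightarrow> 'a) \<times> 'a \<times> 'a \<times> 'a"

type_synonym 'a skew_datum = "('a \<Rightarrow> 'a) \<times> ('a \<Rightarrow> 'a) \<times> 'a \<times> 'a \<times> 'a \<times> 'a"

definition skew_structures :: "'a::monoid_mult skew_structure set" where
  "skew_structures = {(star, \<gamma>, \<eta>, \<epsilon>). skew_monoidal_monoid star \<gamma> \<eta> \<epsilon>}"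

definition skew_data_set :: "'a::monoid_mult skew_datum set" where
  "skew_data_set = {(T, Q, \<mu>, \<eta>, \<delta>, \<epsilon>). skew_data T Q \<mu> \<eta> \<delta> \<epsilon>}"

definition structure_to_data :: "'a::monoid_mult skew_structure \<Rightarrow> 'a skew_datum" where
  "structure_to_data = (\<lambda>(star, \<gamma>, \<eta>, \<epsilon>).
    let T = (\<lambda>a. star 1 a); Q = (\<lambda>a. star a 1)
    in (T, Q, Q \<epsilon> * \<gamma>, \<eta>, \<gamma> * T \<eta>, \<epsilon>))"

definition data_to_structure :: "'a::monoid_mult skew_datum \<Rightarrow> 'a skew_structure" where
  "data_to_structure = (\<lambda>(T, Q, \<mu>, \<eta>, \<delta>, \<epsilon>).
    ((\<lambda>a b. Q a * T b), \<mu> * \<delta>, \<eta>, \<epsilon>))"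

end

theory Submission
  imports Defs
begin

text \<open>
  Everything rests on the factorization \<open>a \<star> b = Q a * T b\<close>. It splits the naturality of \<open>\<gamma>\<close>
  into one relation for each of the three arguments, and then
  \<open>\<mu> * \<delta> = Q \<epsilon> * \<gamma>\<^sup>2 * T \<eta>\<close> collapses, by the pentagon, to \<open>Q (T (\<epsilon> * \<eta>)) * \<gamma> = \<gamma>\<close>.
  Conversely, \<open>Q \<epsilon> * \<mu> * \<delta> = \<mu>\<close> and \<open>\<mu> * \<delta> * T \<eta> = \<delta>\<close> because \<open>\<mu>\<close> commutes with the image
  of \<open>Q\<close> and \<open>\<delta>\<close> with the image of \<open>T\<close>.
\<close>

text \<open>\<open>mult.assoc\<close> nests products to the right, which hides a two-factor
  left-hand side; this form lets such an equation act at the head of a longer product.\<close>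

lemma mult_eq_left:
  fixes a b c x :: "'a::semigroup_mult"
  assumes "a * b = c"
  shows "a * (b * x) = c * x"
  using assms by (simp flip: mult.assoc)

section \<open>From the skew product to two commuting endomorphisms\<close>

context skew_monoidal_monoid
begin

definition T :: "'a \<Rightarrow> 'a" where "T a = 1 \<star> a"
definition Q :: "'a \<Rightarrow> 'a" where "Q a = a \<star> 1"
definition \<mu> :: 'a where "\<mu> = Q \<epsilon> * \<gamma>"
definition \<delta> :: 'a where "\<delta> = \<gamma> * T \<eta>"

text \<open>Interchange applied to \<open>(a * 1) \<star> (1 * b)\<close>.\<close>

lemma star_eq: "a \<star> b = Q a * T b"
  using star_mult[of a 1 1 b] by (simp add: T_def Q_def)

text \<open>Interchange applied to \<open>(1 * a) \<star> (b * 1)\<close> factors the same element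
  in the other order.\<close>

lemma T_commute_Q: "T b * Q a = Q a * T b"
  using star_mult[of 1 a b 1] by (simp flip: star_eq) (simp add: T_def Q_def)

lemma T_one: "T 1 = 1" and Q_one: "Q 1 = 1"
  by (simp_all add: T_def Q_def star_one)

lemma T_mult: "T (a * b) = T a * T b"
  using star_mult[of 1 1 a b] by (simp add: T_def)

lemma Q_mult: "Q (a * b) = Q a * Q b"
  using star_mult[of a b 1 1] by (simp add: Q_def)

lemma gamma_TT: "\<gamma> * T (T a) = T a * \<gamma>"
  using gamma_natural[of 1 1 a] by (simp add: T_def star_one)

lemma gamma_Q: "\<gamma> * Q a = Q (Q a) * \<gamma>"
  using gamma_natural[of a 1 1] by (simp add: Q_def star_one)

lemma gamma_TQ: "\<gamma> * T (Q a) = Q (T a) * \<gamma>"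
  using gamma_natural[of 1 a 1] by (simp add: T_def Q_def)

lemma eta_T: "\<eta> * a = T a * \<eta>"
  by (simp add: T_def eta_natural)

lemma epsilon_Q: "\<epsilon> * Q a = a * \<epsilon>"
  by (simp add: Q_def epsilon_natural)

lemma gamma_gamma: "\<gamma> * \<gamma> = Q \<gamma> * \<gamma> * T \<gamma>"
  using pentagon by (simp add: T_def Q_def power2_eq_square)

lemma gamma_eta_Q: "\<gamma> * \<eta> = Q \<eta>"
  by (simp add: Q_def gamma_eta)

lemma epsilon_gamma_T: "\<epsilon> * \<gamma> = T \<epsilon>"
  by (simp add: T_def epsilon_gamma)

lemma Q_epsilon_gamma_T_eta: "Q \<epsilon> * (\<gamma> * T \<eta>) = 1"
  using epsilon_gamma_eta by (simp add: T_def Q_def mult.assoc)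

lemma mu_mult_delta: "\<mu> * \<delta> = \<gamma>"
proof -
  have "\<mu> * \<delta> = Q \<epsilon> * (\<gamma> * \<gamma>) * T \<eta>"
    by (simp add: \<mu>_def \<delta>_def mult.assoc)
  also have "\<dots> = Q (\<epsilon> * \<gamma>) * \<gamma> * T (\<gamma> * \<eta>)"
    by (simp only: gamma_gamma Q_mult T_mult mult.assoc)
  also have "\<dots> = Q (T \<epsilon>) * (\<gamma> * T (Q \<eta>))"
    by (simp only: epsilon_gamma_T gamma_eta_Q mult.assoc)
  also have "\<dots> = Q (T (\<epsilon> * \<eta>)) * \<gamma>"
    by (simp only: gamma_TQ Q_mult T_mult mult.assoc)
  finally show ?thesis
    by (simp add: epsilon_eta T_one Q_one)
qed

lemma mu_mult_T_mu: "\<mu> * T \<mu> = \<mu>\<^sup>2"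
proof -
  have "\<mu> * T \<mu> = Q \<epsilon> * (\<gamma> * T (Q \<epsilon>)) * T \<gamma>"
    by (simp add: \<mu>_def T_mult mult.assoc)
  also have "\<dots> = Q (\<epsilon> * T \<epsilon>) * \<gamma> * T \<gamma>"
    by (simp add: gamma_TQ Q_mult mult.assoc)
  \<comment> \<open>Writing \<open>T \<epsilon>\<close> as \<open>\<epsilon> * \<gamma>\<close>
    supplies the factor \<open>Q \<gamma>\<close> missing from the pentagon.\<close>
  also have "\<epsilon> * T \<epsilon> = \<epsilon> * Q \<epsilon> * \<gamma>"
    by (simp add: epsilon_Q epsilon_gamma_T mult.assoc)
  also have "Q (\<epsilon> * Q \<epsilon> * \<gamma>) * \<gamma> * T \<gamma> = Q \<epsilon> * Q (Q \<epsilon>) * (Q \<gamma> * \<gamma> * T \<gamma>)"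
    by (simp add: Q_mult mult.assoc)
  also have "\<dots> = Q \<epsilon> * (Q (Q \<epsilon>) * \<gamma>) * \<gamma>"
    by (simp add: gamma_gamma mult_eq_left[OF gamma_gamma] mult.assoc)
  also have "\<dots> = \<mu>\<^sup>2"
    by (simp add: gamma_Q[symmetric] \<mu>_def power2_eq_square mult.assoc)
  finally show ?thesis .
qed

text \<open>The mirror image of \<open>mu_mult_T_mu\<close>: reverse all products and exchange
  \<open>T\<close> with \<open>Q\<close>, \<open>\<mu>\<close> with \<open>\<delta>\<close> and
  \<open>\<eta>\<close> with \<open>\<epsilon>\<close>.\<close>

lemma Q_delta_mult_delta: "Q \<delta> * \<delta> = \<delta>\<^sup>2"
proof -
  have "Q \<delta> * \<delta> = Q \<gamma> * (Q (T \<eta>) * \<gamma>) * T \<eta>"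
    by (simp add: \<delta>_def Q_mult mult.assoc)
  also have "\<dots> = Q \<gamma> * \<gamma> * T (Q \<eta> * \<eta>)"
    by (simp add: gamma_TQ[symmetric] T_mult mult.assoc)
  also have "Q \<eta> * \<eta> = \<gamma> * T \<eta> * \<eta>"
    by (simp add: gamma_eta_Q[symmetric] eta_T[symmetric] mult.assoc)
  also have "Q \<gamma> * \<gamma> * T (\<gamma> * T \<eta> * \<eta>) = Q \<gamma> * \<gamma> * T \<gamma> * (T (T \<eta>) * T \<eta>)"
    by (simp add: T_mult mult.assoc)
  also have "\<dots> = \<gamma> * (\<gamma> * T (T \<eta>)) * T \<eta>"
    by (simp add: gamma_gamma mult_eq_left[OF gamma_gamma] mult.assoc)
  also have "\<dots> = \<delta>\<^sup>2"
    by (simp add: gamma_TT \<delta>_def power2_eq_square mult.assoc)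
  finally show ?thesis .
qed

text \<open>Fusing \<open>\<mu> * \<delta>\<close> into \<open>\<gamma>\<close> exposes the
  pentagon, hence \<open>\<gamma> * \<gamma>\<close>. The outer \<open>Q (Q \<epsilon>)\<close> and
  \<open>T (T \<eta>)\<close> then pass inward and meet between the two copies of
  \<open>\<gamma>\<close>, where they commute.\<close>

lemma delta_mult_mu: "Q \<mu> * \<mu> * \<delta> * T \<delta> = \<delta> * \<mu>"
proof -
  have "Q \<mu> * \<mu> * \<delta> * T \<delta> = Q \<mu> * (\<mu> * \<delta>) * T \<delta>"
    by (simp add: mult.assoc)
  also have "\<dots> = Q (Q \<epsilon>) * (Q \<gamma> * \<gamma> * T \<gamma>) * T (T \<eta>)"
    by (simp only: mu_mult_delta) (simp only: \<mu>_def \<delta>_def Q_mult T_mult mult.assoc)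
  also have "\<dots> = (Q (Q \<epsilon>) * \<gamma>) * (\<gamma> * T (T \<eta>))"
    by (simp add: mult_eq_left[OF gamma_gamma] mult.assoc)
  also have "\<dots> = \<gamma> * (Q \<epsilon> * T \<eta>) * \<gamma>"
    by (simp only: gamma_TT gamma_Q[symmetric] mult.assoc)
  also have "\<dots> = \<delta> * \<mu>"
    by (simp only: T_commute_Q[symmetric] \<delta>_def \<mu>_def mult.assoc)
  finally show ?thesis .
qed

lemma skew_data: "skew_data T Q \<mu> \<eta> \<delta> \<epsilon>"
proof unfold_locales
  fix a b
  show "T 1 = 1" "Q 1 = 1" "T (a * b) = T a * T b" "Q (a * b) = Q a * Q b"
    by (fact T_one Q_one T_mult Q_mult)+
  show "\<mu> * T (T a) = T a * \<mu>"
    by (simp add: \<mu>_def gamma_TT mult.assoc mult_eq_left[OF T_commute_Q])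
  show "\<eta> * a = T a * \<eta>"
    by (fact eta_T)
  show "\<delta> * Q a = Q (Q a) * \<delta>"
    by (simp add: \<delta>_def T_commute_Q mult.assoc mult_eq_left[OF gamma_Q])
  show "a * \<epsilon> = \<epsilon> * Q a"
    by (simp add: epsilon_Q)
  show "\<mu> * \<delta> * T (Q a) = Q (T a) * \<mu> * \<delta>"
    by (simp add: mu_mult_delta gamma_TQ mult.assoc)
  show "T a * Q b = Q b * T a"
    by (fact T_commute_Q)
  show "\<mu> * Q a = Q a * \<mu>"
  proof -
    \<comment> \<open>Passing \<open>\<gamma>\<close> adds a layer of \<open>Q\<close>; naturality
      of \<open>\<epsilon>\<close>, applied under \<open>Q\<close>, removes it again.\<close>
    have "\<mu> * Q a = Q (\<epsilon> * Q a) * \<gamma>"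
      by (simp add: \<mu>_def gamma_Q Q_mult mult.assoc)
    then show ?thesis
      by (simp add: epsilon_Q \<mu>_def Q_mult mult.assoc)
  qed
  show "\<delta> * T a = T a * \<delta>"
  proof -
    \<comment> \<open>Dually, \<open>\<eta>\<close> adds a layer of \<open>T\<close> under
      \<open>T\<close>, and \<open>\<gamma>\<close> removes it.\<close>
    have "\<delta> * T a = \<gamma> * T (\<eta> * a)"
      by (simp add: \<delta>_def T_mult mult.assoc)
    then show ?thesis
      by (simp add: eta_T \<delta>_def T_mult mult_eq_left[OF gamma_TT] mult.assoc)
  qed
  show "\<mu> * T \<mu> = \<mu>\<^sup>2" "Q \<delta> * \<delta> = \<delta>\<^sup>2" "Q \<mu> * \<mu> * \<delta> * T \<delta> = \<delta> * \<mu>"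
    by (fact mu_mult_T_mu Q_delta_mult_delta delta_mult_mu)+
  show "\<mu> * \<eta> = 1"
    by (simp add: \<mu>_def gamma_eta_Q Q_mult[symmetric] epsilon_eta Q_one mult.assoc)
  \<comment> \<open>Both products are \<open>Q \<epsilon> * \<gamma> * T \<eta>\<close>.\<close>
  show "\<mu> * T \<eta> = 1" "Q \<epsilon> * \<delta> = 1"
    by (simp_all add: \<mu>_def \<delta>_def Q_epsilon_gamma_T_eta mult.assoc)
  show "\<epsilon> * \<delta> = 1"
    by (simp add: \<delta>_def mult_eq_left[OF epsilon_gamma_T] T_mult[symmetric] epsilon_eta T_one)
  show "\<epsilon> * \<mu> = \<epsilon> * T \<epsilon>"
    by (simp add: \<mu>_def mult_eq_left[OF epsilon_Q] epsilon_gamma_T mult.assoc)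
  show "\<delta> * \<eta> = Q \<eta> * \<eta>"
    by (simp add: \<delta>_def eta_T[symmetric] mult_eq_left[OF gamma_eta_Q] mult.assoc)
  show "\<epsilon> * \<eta> = 1"
    by (fact epsilon_eta)
qed

lemma structure_to_data_eq:
  "structure_to_data (star, \<gamma>, \<eta>, \<epsilon>) = (T, Q, \<mu>, \<eta>, \<delta>, \<epsilon>)"
  by (simp add: structure_to_data_def Let_def T_def Q_def \<mu>_def \<delta>_def fun_eq_iff)

lemma data_to_structure_inverse:
  "data_to_structure (structure_to_data (star, \<gamma>, \<eta>, \<epsilon>)) = (star, \<gamma>, \<eta>, \<epsilon>)"
  by (simp add: structure_to_data_eq data_to_structure_def mu_mult_delta star_eq fun_eq_iff)

end

section \<open>From the two endomorphisms back to the skew product\<close>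

context skew_data
begin

text \<open>With \<open>gamma_TT\<close> and the axiom \<open>mu_delta_TQ\<close>, this gives
  naturality of the associator in each argument separately.\<close>

lemma gamma_Q: "\<mu> * \<delta> * Q a = Q (Q a) * (\<mu> * \<delta>)"
  by (simp add: delta_Q mult_eq_left[OF mu_Q_commute] mult.assoc)

lemma gamma_TT: "\<mu> * \<delta> * T (T a) = T a * (\<mu> * \<delta>)"
  by (simp add: delta_T_commute mult_eq_left[OF mu_T] mult.assoc)

text \<open>The commutation relations bring \<open>Q \<delta>\<close> next to
  \<open>\<delta>\<close> and \<open>\<mu>\<close> next to \<open>T \<mu>\<close>; both pairs
  collapse to squares. Moving one \<open>\<mu>\<close> to the far left and one
  \<open>\<delta>\<close> to the far right leaves the left side of \<open>delta_mu\<close> in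
  between.\<close>

lemma gamma_pentagon: "Q (\<mu> * \<delta>) * (\<mu> * \<delta>) * T (\<mu> * \<delta>) = (\<mu> * \<delta>)\<^sup>2"
proof -
  have "Q (\<mu> * \<delta>) * (\<mu> * \<delta>) * T (\<mu> * \<delta>) = Q \<mu> * (Q \<delta> * \<mu>) * \<delta> * T \<mu> * T \<delta>"
    by (simp add: Q.map_mult T.map_mult mult.assoc)
  also have "\<dots> = Q \<mu> * \<mu> * (Q \<delta> * \<delta>) * T \<mu> * T \<delta>"
    by (simp add: mult_eq_left[OF mu_Q_commute] mult.assoc)
  also have "\<dots> = Q \<mu> * \<mu> * \<delta> * (\<delta> * T \<mu>) * T \<delta>"
    by (simp add: Q_delta_delta power2_eq_square mult.assoc)
  also have "\<dots> = Q \<mu> * (\<mu> * T \<mu>) * \<delta> * \<delta> * T \<delta>"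
    by (simp add: delta_T_commute mult_eq_left[OF delta_T_commute] mult.assoc)
  also have "\<dots> = Q \<mu> * \<mu> * \<mu> * \<delta> * (\<delta> * T \<delta>)"
    by (simp add: mu_T_mu power2_eq_square mult.assoc)
  also have "\<dots> = \<mu> * (Q \<mu> * \<mu> * \<delta> * T \<delta>) * \<delta>"
    by (simp add: delta_T_commute mult_eq_left[OF delta_T_commute]
        mult_eq_left[OF mu_Q_commute] mult.assoc)
  also have "\<dots> = (\<mu> * \<delta>)\<^sup>2"
    by (simp only: delta_mu) (simp only: power2_eq_square mult.assoc)
  finally show ?thesis .
qed

lemma skew_monoidal_monoid: "skew_monoidal_monoid (\<lambda>a b. Q a * T b) (\<mu> * \<delta>) \<eta> \<epsilon>"
proof
  fix a b c d
  show "Q (a * b) * T (c * d) = Q a * T c * (Q b * T d)"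
    by (simp add: Q.map_mult T.map_mult mult_eq_left[OF T_Q_commute] mult.assoc)
  show "Q 1 * T 1 = 1"
    by (simp add: Q.map_one T.map_one)
  show "\<mu> * \<delta> * (Q a * T (Q b * T c)) = Q (Q a * T b) * T c * (\<mu> * \<delta>)"
  proof -
    have "\<mu> * \<delta> * (Q a * T (Q b * T c)) = (\<mu> * \<delta> * Q a) * T (Q b) * T (T c)"
      by (simp add: T.map_mult mult.assoc)
    also have "\<dots> = Q (Q a) * (\<mu> * \<delta> * T (Q b)) * T (T c)"
      \<comment> \<open>The law is applied before reassociation, which would break up the bracketed
        product it matches.\<close>
      by (simp only: gamma_Q) (simp only: mult.assoc)
    also have "\<dots> = Q (Q a) * Q (T b) * (\<mu> * \<delta> * T (T c))"
      by (simp only: mu_delta_TQ) (simp only: mult.assoc)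
    also have "\<dots> = Q (Q a * T b) * T c * (\<mu> * \<delta>)"
      by (simp only: gamma_TT) (simp only: Q.map_mult mult.assoc)
    finally show ?thesis .
  qed
  show "\<eta> * a = Q 1 * T a * \<eta>"
    by (simp add: Q.map_one eta_T)
  show "a * \<epsilon> = \<epsilon> * (Q a * T 1)"
    by (simp add: T.map_one epsilon_Q)
  show "Q (\<mu> * \<delta>) * T 1 * (\<mu> * \<delta>) * (Q 1 * T (\<mu> * \<delta>)) = (\<mu> * \<delta>)\<^sup>2"
    using gamma_pentagon by (simp add: Q.map_one T.map_one)
  show "\<mu> * \<delta> * \<eta> = Q \<eta> * T 1"
    by (simp add: delta_eta mult_eq_left[OF mu_Q_commute] mu_eta T.map_one mult.assoc)
  \<comment> \<open>\<open>\<epsilon> * \<mu>\<close> becomes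
    \<open>\<epsilon> * T \<epsilon>\<close>; then \<open>\<delta>\<close> passes
    \<open>T \<epsilon>\<close> and cancels against \<open>\<epsilon>\<close>.\<close>
  show "\<epsilon> * (\<mu> * \<delta>) = Q 1 * T \<epsilon>"
    by (simp add: mult_eq_left[OF epsilon_mu] delta_T_commute[symmetric]
        mult_eq_left[OF epsilon_delta] Q.map_one mult.assoc)
  \<comment> \<open>Moving \<open>\<mu>\<close> left past \<open>Q \<epsilon>\<close> lets
    \<open>Q \<epsilon> * \<delta>\<close> cancel, leaving \<open>\<mu> * T \<eta>\<close>.\<close>
  show "Q \<epsilon> * T 1 * (\<mu> * \<delta>) * (Q 1 * T \<eta>) = 1"
    by (simp add: mult_eq_left[OF mu_Q_commute[symmetric]] mult_eq_left[OF Q_epsilon_delta]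
        mu_T_eta Q.map_one T.map_one mult.assoc)
  show "\<epsilon> * \<eta> = 1"
    by (fact epsilon_eta)
qed

lemma structure_to_data_inverse:
  "structure_to_data (data_to_structure (T, Q, \<mu>, \<eta>, \<delta>, \<epsilon>)) = (T, Q, \<mu>, \<eta>, \<delta>, \<epsilon>)"
proof -
  have "Q \<epsilon> * (\<mu> * \<delta>) = \<mu>"
    by (simp add: mult_eq_left[OF mu_Q_commute[symmetric]] Q_epsilon_delta mult.assoc)
  moreover have "\<mu> * \<delta> * T \<eta> = \<delta>"
    by (simp add: delta_T_commute mult_eq_left[OF mu_T_eta] mult.assoc)
  \<comment> \<open>The endomorphisms return as \<open>Q 1 * T a\<close> and
    \<open>Q a * T 1\<close>, so preservation of the unit recovers them.\<close>
  ultimately show ?thesis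
    by (simp add: structure_to_data_def data_to_structure_def Let_def Q.map_one T.map_one
        fun_eq_iff)
qed

end

theorem proposition1p2:
  "bij_betw (structure_to_data :: 'a::monoid_mult skew_structure \<Rightarrow> 'a skew_datum)
     skew_structures skew_data_set
   \<and> bij_betw (data_to_structure :: 'a skew_datum \<Rightarrow> 'a skew_structure)
     skew_data_set skew_structures
   \<and> (\<forall>S \<in> (skew_structures :: 'a skew_structure set).
        data_to_structure (structure_to_data S) = S)
   \<and> (\<forall>D \<in> (skew_data_set :: 'a skew_datum set).
        structure_to_data (data_to_structure D) = D)"
proof -
  have inv1: "\<forall>S \<in> (skew_structures :: 'a skew_structure set).
      data_to_structure (structure_to_data S) = S"
    by (auto simp: skew_structures_def intro: skew_monoidal_monoid.data_to_structure_inverse)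
  have inv2: "\<forall>D \<in> (skew_data_set :: 'a skew_datum set).
      structure_to_data (data_to_structure D) = D"
    by (auto simp: skew_data_set_def intro: skew_data.structure_to_data_inverse)
  have maps1: "structure_to_data ` skew_structures \<subseteq> (skew_data_set :: 'a skew_datum set)"
    by (auto simp: skew_structures_def skew_data_set_def
        skew_monoidal_monoid.structure_to_data_eq skew_monoidal_monoid.skew_data)
  have maps2: "data_to_structure ` skew_data_set \<subseteq> (skew_structures :: 'a skew_structure set)"
    by (auto simp: skew_structures_def skew_data_set_def data_to_structure_def
        skew_data.skew_monoidal_monoid)
  show ?thesis
    using inv1 inv2 bij_betw_byWitness[OF inv1 inv2 maps1 maps2]
      bij_betw_byWitness[OF inv2 inv1 maps2 maps1] by blast
qed

end
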